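(* Let $n\ge 1$ be an integer, let $0<\lambda<n$ be real, and put $p=\frac{2n}{2n-\lambda}$. Define $$C(n,\lambda)=\left\{\frac{\pi^{n/2}\,\Gamma\left(\frac n2-\frac\lambda2\right)\Gamma\left(\frac\lambda4\right)^2}{\Gamma\left(\frac\lambda2\right)\Gamma\left(\frac n2-\frac\lambda4\right)^2}\right\}^{-\frac{2n-\lambda}{2(n-\lambda)}}$$ and $$f(x)=C(n,\lambda)\,|x|^{-(n-\lambda/2)},\qquad x\in\mathbb{R}^n\setminus\{0\}.$$ Then $f$ is a solution of the integral equation $$\int_{\mathbb{R}^n}|x-y|^{-\lambda}f(y)\,dy=f(x)^{p-1},\qquad x\in\mathbb{R}^n\setminus\{0\}.$$
   Context: $|\cdot|$ is the Euclidean norm on $\mathbb{R}^n$, $\Gamma$ is Euler's Gamma function, and $dy$ is Lebesgue measure. *)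

theory Defs
  imports "HOL-Analysis.Analysis"
begin

definition riesz_C :: "nat \<Rightarrow> real \<Rightarrow> real" where
  "riesz_C n lam =
     (pi powr (real n / 2) * Gamma (real n / 2 - lam / 2) * (Gamma (lam / 4))\<^sup>2 /
       (Gamma (lam / 2) * (Gamma (real n / 2 - lam / 4))\<^sup>2))
     powr (- ((2 * real n - lam) / (2 * (real n - lam))))"

text \<open>
  The equation is required only at \<open>x \<noteq> 0\<close>. It includes convergence of the integral, since the
  Bochner integral of a non-integrable function is 0 by convention.
  The values of \<open>f\<close> at the origin and of the kernel at \<open>y = x\<close> (where \<open>0 powr a = 0\<close>)
  are irrelevant, as they affect the integrand only on a null set.
\<close>

definition solves_riesz_equation :: "real \<Rightarrow> real \<Rightarrow> (real ^ 'n \<Rightarrow> real) \<Rightarrow> bool" where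
  "solves_riesz_equation lam p f \<longleftrightarrow>
     (\<forall>x. x \<noteq> 0 \<longrightarrow>
        integrable lebesgue (\<lambda>y. norm (x - y) powr (- lam) * f y) \<and>
        (LINT y|lebesgue. norm (x - y) powr (- lam) * f y) = f x powr (p - 1))"

end

theory Submission
  imports Defs "HOL-Probability.Distributions"
begin

text \<open>
  Inserting \<open>f = C |x|\<^sup>-\<^sup>b\<close> with \<open>b = n - \<lambda>/2\<close> into the equation leaves one integral to compute, the
  Riesz composition \<open>\<integral> |x - y|\<^sup>-\<^sup>a |y|\<^sup>-\<^sup>b dy\<close> with \<open>a = \<lambda>\<close>. By rotation and dilation symmetry it is a
  multiple \<open>K\<close> of \<open>|x|\<close> to the power \<open>n - a - b = - \<lambda>/2 = - b (p - 1)\<close>, which is the power on the right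
  side. So the equation holds as soon as \<open>C K\<close> equals \<open>C\<close> to the power \<open>p - 1\<close>; solving this for \<open>C\<close>
  gives \<open>C(n,\<lambda>)\<close>, since \<open>1 / (p - 2) = - (2 n - \<lambda>) / (2 (n - \<lambda>))\<close> and \<open>K\<close> is the
  expression in braces in the definition of \<open>C(n,\<lambda>)\<close>.

  The value of \<open>K\<close> comes from writing both powers as superpositions of Gaussians,
  \<open>\<Gamma>(a/2) |z|\<^sup>-\<^sup>a = \<integral> s^(a/2 - 1) exp(- s |z|\<^sup>2) ds\<close> over \<open>s > 0\<close>
  (\<open>norm_powr_eq_gaussian_superposition\<close>). After exchanging the integrals, the integral over \<open>y\<close> is
  Gaussian: completing the square gives \<open>(\<pi> / (s + t))^(n/2) exp(- s t / (s + t) |x|\<^sup>2)\<close>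
  (\<open>nn_integral_gaussian_product\<close>). In the remaining integral over \<open>s, t > 0\<close> the substitution
  \<open>s = t v\<close> makes the exponent linear in \<open>t\<close>, so that the \<open>t\<close>-integral is a Gamma integral and the
  \<open>v\<close>-integral a Beta integral on the half-line (\<open>nn_integral_two_scales\<close>).

  All integrands are nonnegative. The computation is therefore carried out in the extended
  nonnegative reals, where Tonelli's theorem applies without integrability conditions;
  integrability of the original integrand follows at the end from the finiteness of the result.
\<close>

section \<open>Integrals over the half-line\<close>

lemma nn_integral_half_line_scale:
  fixes F :: "real \<Rightarrow> ennreal"
  assumes [measurable]: "F \<in> borel_measurable borel" and "0 < t"
  shows "(\<integral>\<^sup>+s\<in>{0<..}. F s \<partial>lborel) = ennreal t * (\<integral>\<^sup>+v\<in>{0<..}. F (t * v) \<partial>lborel)"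
proof -
  have "(\<integral>\<^sup>+s\<in>{0<..}. F s \<partial>lborel) = ennreal \<bar>t\<bar> * (\<integral>\<^sup>+v. F (0 + t * v) * indicator {0<..} (0 + t * v) \<partial>lborel)"
    using assms by (intro nn_integral_real_affine) auto
  also have "(\<lambda>v. indicator {0<..} (0 + t * v) :: ennreal) = indicator {0<..}"
    using assms by (auto simp: indicator_def zero_less_mult_iff)
  finally show ?thesis
    using assms by (simp add: fun_eq_iff)
qed

lemma nn_integral_half_line_swap:
  fixes F :: "real \<Rightarrow> 'a::euclidean_space \<Rightarrow> ennreal"
  assumes [measurable]: "case_prod F \<in> borel_measurable (borel \<Otimes>\<^sub>M borel)"
  shows "(\<integral>\<^sup>+y. (\<integral>\<^sup>+t\<in>{0<..}. F t y \<partial>lborel) \<partial>lborel) = (\<integral>\<^sup>+t\<in>{0<..}. (\<integral>\<^sup>+y. F t y \<partial>lborel) \<partial>lborel)"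
proof -
  have "(\<integral>\<^sup>+y. (\<integral>\<^sup>+t\<in>{0<..}. F t y \<partial>lborel) \<partial>lborel) = (\<integral>\<^sup>+t. (\<integral>\<^sup>+y. F t y * indicator {0<..} t \<partial>lborel) \<partial>lborel)"
    by (intro lborel_pair.Fubini') measurable
  also have "\<dots> = (\<integral>\<^sup>+t\<in>{0<..}. (\<integral>\<^sup>+y. F t y \<partial>lborel) \<partial>lborel)"
    by (intro nn_integral_cong nn_integral_multc) measurable
  finally show ?thesis .
qed

lemma nn_integral_quadrant_swap:
  fixes F :: "real \<Rightarrow> real \<Rightarrow> ennreal"
  assumes [measurable]: "case_prod F \<in> borel_measurable (borel \<Otimes>\<^sub>M borel)"
  shows "(\<integral>\<^sup>+s\<in>{0<..}. (\<integral>\<^sup>+t\<in>{0<..}. F t s \<partial>lborel) \<partial>lborel) = (\<integral>\<^sup>+t\<in>{0<..}. (\<integral>\<^sup>+s\<in>{0<..}. F t s \<partial>lborel) \<partial>lborel)"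
proof -
  have "(\<integral>\<^sup>+s\<in>{0<..}. (\<integral>\<^sup>+t\<in>{0<..}. F t s \<partial>lborel) \<partial>lborel)
      = (\<integral>\<^sup>+s. (\<integral>\<^sup>+t\<in>{0<..}. F t s * indicator {0<..} s \<partial>lborel) \<partial>lborel)"
    by (subst nn_integral_multc[symmetric]) (measurable, simp add: mult_ac)
  also have "\<dots> = (\<integral>\<^sup>+t\<in>{0<..}. (\<integral>\<^sup>+s\<in>{0<..}. F t s \<partial>lborel) \<partial>lborel)"
    by (intro nn_integral_half_line_swap) measurable
  finally show ?thesis .
qed

lemma nn_integral_Gamma_scaled:
  assumes "0 < c" "0 < (k::real)"
  shows "(\<integral>\<^sup>+t\<in>{0<..}. ennreal (t powr (c - 1) * exp (- (k * t))) \<partial>lborel) = ennreal (Gamma c * k powr (- c))"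
proof -
  have "ennreal (Gamma c) = (\<integral>\<^sup>+t\<in>{0<..}. ennreal (t powr (c - 1) * exp (- t)) \<partial>lborel)"
    unfolding Gamma_conv_nn_integral_real[OF assms(1)]
    by (intro nn_integral_cong) (auto simp: indicator_def exp_minus field_simps)
  also have "\<dots> = ennreal k * (\<integral>\<^sup>+t\<in>{0<..}. ennreal ((k * t) powr (c - 1) * exp (- (k * t))) \<partial>lborel)"
    using assms by (intro nn_integral_half_line_scale) auto
  also have "\<dots> = (\<integral>\<^sup>+t. ennreal (k powr c) * (ennreal (t powr (c - 1) * exp (- (k * t))) * indicator {0<..} t) \<partial>lborel)"
    using assms
    by (subst nn_integral_cmult[symmetric], measurable)
       (auto intro!: nn_integral_cong simp: indicator_def powr_mult ennreal_mult'[symmetric] powr_diff)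
  also have "\<dots> = ennreal (k powr c) * (\<integral>\<^sup>+t\<in>{0<..}. ennreal (t powr (c - 1) * exp (- (k * t))) \<partial>lborel)"
    by (intro nn_integral_cmult) measurable
  finally have "ennreal (k powr (- c)) * ennreal (Gamma c) = ennreal (k powr (- c)) * \<dots>"
    by simp
  also have "\<dots> = (\<integral>\<^sup>+t\<in>{0<..}. ennreal (t powr (c - 1) * exp (- (k * t))) \<partial>lborel)"
    using assms by (simp add: mult.assoc[symmetric] ennreal_mult'[symmetric] powr_add[symmetric])
  finally show ?thesis
    using assms by (simp add: ennreal_mult' mult.commute)
qed

text \<open>
  The substitution \<open>u = v / (1 + v)\<close> would turn this into the Beta integral on the unit interval. It is
  shorter to compute the double integral of \<open>v^(p - 1) t^(p + q - 1) exp(- (1 + v) t)\<close> in both orders: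
  integrating over \<open>t\<close> first produces \<open>\<Gamma>(p + q)\<close> times the integral in question, integrating over \<open>v\<close>
  first produces \<open>\<Gamma>(p) \<Gamma>(q)\<close>.
\<close>
lemma nn_integral_beta_second_kind:
  assumes "0 < p" "0 < (q::real)"
  shows "(\<integral>\<^sup>+v\<in>{0<..}. ennreal (v powr (p - 1) * (1 + v) powr (- (p + q))) \<partial>lborel) = ennreal (Beta p q)"
proof -
  define F where "F t v = ennreal (v powr (p - 1) * t powr (p + q - 1) * exp (- ((1 + v) * t)))" for t v :: real
  have [measurable]: "case_prod F \<in> borel_measurable (borel \<Otimes>\<^sub>M borel)"
    unfolding F_def by measurable
  have Gpos: "0 < Gamma p" "0 < Gamma q" "0 < Gamma (p + q)"
    using assms by (auto intro: Gamma_real_pos)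
  have inner_t: "(\<integral>\<^sup>+t\<in>{0<..}. F t v \<partial>lborel)
      = ennreal (Gamma (p + q)) * ennreal (v powr (p - 1) * (1 + v) powr (- (p + q)))" if "0 < v" for v
  proof -
    have "(\<integral>\<^sup>+t\<in>{0<..}. F t v \<partial>lborel)
        = (\<integral>\<^sup>+t. ennreal (v powr (p - 1)) * (ennreal (t powr (p + q - 1) * exp (- ((1 + v) * t))) * indicator {0<..} t) \<partial>lborel)"
      unfolding F_def by (intro nn_integral_cong) (simp add: ennreal_mult' mult_ac)
    also have "\<dots> = ennreal (v powr (p - 1)) * ennreal (Gamma (p + q) * (1 + v) powr (- (p + q)))"
      using assms that by (subst nn_integral_cmult, measurable) (subst nn_integral_Gamma_scaled, auto)
    finally show ?thesis
      using Gpos by (simp add: ennreal_mult' mult_ac)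
  qed
  have inner_v: "(\<integral>\<^sup>+v\<in>{0<..}. F t v \<partial>lborel)
      = ennreal (Gamma p) * ennreal (t powr (q - 1) * exp (- (1 * t)))" if "0 < t" for t
  proof -
    have "(\<integral>\<^sup>+v\<in>{0<..}. F t v \<partial>lborel)
        = (\<integral>\<^sup>+v. ennreal (t powr (p + q - 1) * exp (- t)) * (ennreal (v powr (p - 1) * exp (- (t * v))) * indicator {0<..} v) \<partial>lborel)"
      unfolding F_def
      by (intro nn_integral_cong) (simp add: ennreal_mult'[symmetric] mult_ac exp_add[symmetric] algebra_simps indicator_def)
    also have "\<dots> = ennreal (t powr (p + q - 1) * exp (- t)) * ennreal (Gamma p * t powr (- p))"
      using assms that by (subst nn_integral_cmult, measurable) (subst nn_integral_Gamma_scaled, auto)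
    also have "\<dots> = ennreal (Gamma p * ((t powr (p + q - 1) * t powr (- p)) * exp (- t)))"
      using Gpos by (simp add: ennreal_mult'[symmetric] mult_ac)
    also have "t powr (p + q - 1) * t powr (- p) = t powr (q - 1)"
      by (simp add: powr_add[symmetric])
    finally show ?thesis
      using Gpos by (simp add: ennreal_mult')
  qed
  have "ennreal (Gamma (p + q)) * (\<integral>\<^sup>+v\<in>{0<..}. ennreal (v powr (p - 1) * (1 + v) powr (- (p + q))) \<partial>lborel)
      = (\<integral>\<^sup>+v\<in>{0<..}. (\<integral>\<^sup>+t\<in>{0<..}. F t v \<partial>lborel) \<partial>lborel)"
    by (subst nn_integral_cmult[symmetric], measurable)
       (auto intro!: nn_integral_cong simp: inner_t split: split_indicator)
  also have "\<dots> = (\<integral>\<^sup>+t\<in>{0<..}. (\<integral>\<^sup>+v\<in>{0<..}. F t v \<partial>lborel) \<partial>lborel)"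
    by (intro nn_integral_quadrant_swap) measurable
  also have "\<dots> = (\<integral>\<^sup>+t. ennreal (Gamma p) * (ennreal (t powr (q - 1) * exp (- (1 * t))) * indicator {0<..} t) \<partial>lborel)"
    by (auto intro!: nn_integral_cong simp: inner_v split: split_indicator)
  also have "\<dots> = ennreal (Gamma p) * ennreal (Gamma q * 1 powr (- q))"
    using assms by (subst nn_integral_cmult, measurable) (subst nn_integral_Gamma_scaled, auto)
  finally have "ennreal (inverse (Gamma (p + q))) * (ennreal (Gamma (p + q)) * (\<integral>\<^sup>+v\<in>{0<..}. ennreal (v powr (p - 1) * (1 + v) powr (- (p + q))) \<partial>lborel))
     = ennreal (inverse (Gamma (p + q))) * ennreal (Gamma p * Gamma q)"
    using Gpos by (simp add: ennreal_mult')
  then show ?thesis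
    using Gpos by (simp add: mult.assoc[symmetric] ennreal_mult'[symmetric] Beta_def field_simps)
qed

section \<open>Gaussian integrals\<close>

lemma nn_integral_gaussian_real:
  assumes "0 < (k::real)"
  shows "(\<integral>\<^sup>+y. ennreal (exp (- (k * y\<^sup>2))) \<partial>lborel) = ennreal (sqrt (pi / k))"
proof -
  \<comment> \<open>The standard deviation for which the exponent of the normal density is \<open>- k y\<^sup>2\<close>.\<close>
  define \<sigma> where "\<sigma> = sqrt (1 / (2 * k))"
  have \<sigma>: "0 < \<sigma>" "\<sigma>\<^sup>2 = 1 / (2 * k)"
    using assms by (auto simp: \<sigma>_def)
  have "(\<integral>\<^sup>+y. ennreal (normal_density 0 \<sigma> y) \<partial>lborel) = 1"
    using \<sigma> by (subst nn_integral_eq_integral) auto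
  moreover have "ennreal (exp (- (k * y\<^sup>2))) = ennreal (sqrt (pi / k)) * ennreal (normal_density 0 \<sigma> y)" for y
    using assms by (simp add: normal_density_def \<sigma> ennreal_mult'[symmetric] field_simps real_sqrt_divide)
  ultimately show ?thesis
    by (simp add: nn_integral_cmult)
qed

lemma nn_integral_gaussian:
  assumes "0 < k"
  shows "(\<integral>\<^sup>+y. ennreal (exp (- (k * (norm (y::'a::euclidean_space))\<^sup>2))) \<partial>lborel) = ennreal ((pi / k) powr (real DIM('a) / 2))"
proof -
  have "exp (- (k * (norm y)\<^sup>2)) = (\<Prod>b\<in>Basis. exp (- (k * (y \<bullet> b)\<^sup>2)))" for y :: 'a
    unfolding power2_norm_eq_inner euclidean_inner[of y y]
    by (simp add: exp_sum[symmetric] sum_negf sum_distrib_left power2_eq_square)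
  then have "(\<integral>\<^sup>+y. ennreal (exp (- (k * (norm (y::'a))\<^sup>2))) \<partial>lborel)
      = (\<integral>\<^sup>+y. (\<Prod>b\<in>Basis. ennreal (exp (- (k * ((y::'a) \<bullet> b)\<^sup>2)))) \<partial>lborel)"
    by (simp add: prod_ennreal)
  also have "\<dots> = (\<Prod>b\<in>(Basis::'a set). \<integral>\<^sup>+y. ennreal (exp (- (k * y\<^sup>2))) \<partial>lborel)"
    by (intro nn_integral_lborel_prod) auto
  also have "\<dots> = ennreal (sqrt (pi / k) ^ DIM('a))"
    using assms by (simp add: nn_integral_gaussian_real ennreal_power)
  also have "sqrt (pi / k) ^ DIM('a) = (pi / k) powr (real DIM('a) / 2)"
    using assms by (simp add: powr_half_sqrt[symmetric] powr_realpow[symmetric] powr_powr del: powr_half_sqrt)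
  finally show ?thesis .
qed

text \<open>
  The exponent is a quadratic polynomial in \<open>y\<close> whose minimum lies at the weighted mean
  \<open>c = s / (s + t) x\<close> of \<open>x\<close> and the origin and has the value \<open>s t / (s + t) |x|\<^sup>2\<close>. Translating by
  \<open>c\<close> reduces the integral to a centred Gaussian with parameter \<open>s + t\<close>.
\<close>
lemma nn_integral_gaussian_product:
  fixes x :: "'a::euclidean_space"
  assumes "0 < s" "0 < t"
  shows "(\<integral>\<^sup>+y. ennreal (exp (- (s * (norm (x - y))\<^sup>2)) * exp (- (t * (norm y)\<^sup>2))) \<partial>lborel)
    = ennreal ((pi / (s + t)) powr (real DIM('a) / 2) * exp (- (s * t / (s + t) * (norm x)\<^sup>2)))"
proof -
  define u where "u = s / (s + t)"
  define c where "c = u *\<^sub>R x"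
  have u: "(s + t) * u = s"
    using assms by (simp add: u_def)
  have square: "s * (norm (x - (c + y)))\<^sup>2 + t * (norm (c + y))\<^sup>2
      = (s + t) * (norm y)\<^sup>2 + s * t / (s + t) * (norm x)\<^sup>2" for y
  proof -
    have c: "c \<bullet> y = u * (x \<bullet> y)" "c \<bullet> c = u * (u * (x \<bullet> x))" "c \<bullet> x = u * (x \<bullet> x)"
      by (auto simp: c_def)
    have "s * (norm (x - (c + y)))\<^sup>2 + t * (norm (c + y))\<^sup>2
      = s * (x \<bullet> x) + (s + t) * (c \<bullet> c + 2 * (c \<bullet> y) + y \<bullet> y) - 2 * s * (c \<bullet> x + x \<bullet> y)"
      by (simp add: power2_norm_eq_inner algebra_simps inner_commute)
    also have "\<dots> = s * (x \<bullet> x) + ((s + t) * u) * (u * (x \<bullet> x)) + 2 * ((s + t) * u) * (x \<bullet> y)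
        + (s + t) * (y \<bullet> y) - 2 * s * (u * (x \<bullet> x) + x \<bullet> y)"
      unfolding c by (simp add: algebra_simps)
    also have "\<dots> = (s + t) * (y \<bullet> y) + (s - s * u) * (x \<bullet> x)"
      unfolding u by (simp add: algebra_simps)
    also have "s - s * u = s * t / (s + t)"
      using assms by (simp add: u_def field_simps)
    finally show ?thesis
      by (simp add: power2_norm_eq_inner)
  qed
  have "(\<integral>\<^sup>+y. ennreal (exp (- (s * (norm (x - y))\<^sup>2)) * exp (- (t * (norm y)\<^sup>2))) \<partial>lborel)
      = (\<integral>\<^sup>+y. ennreal (exp (- (s * (norm (x - (c + y)))\<^sup>2)) * exp (- (t * (norm (c + y))\<^sup>2))) \<partial>lborel)"
    by (subst lborel_distr_plus[of c, symmetric], subst nn_integral_distr) auto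
  also have "\<dots> = (\<integral>\<^sup>+y. ennreal (exp (- (s * t / (s + t) * (norm x)\<^sup>2))) * ennreal (exp (- ((s + t) * (norm (y::'a))\<^sup>2))) \<partial>lborel)"
  proof (intro nn_integral_cong)
    fix y :: 'a
    have "exp (- (s * (norm (x - (c + y)))\<^sup>2)) * exp (- (t * (norm (c + y))\<^sup>2))
        = exp (- (s * t / (s + t) * (norm x)\<^sup>2)) * exp (- ((s + t) * (norm y)\<^sup>2))"
      unfolding exp_add[symmetric] by (intro arg_cong[of _ _ exp]) (use square[of y] in linarith)
    then show "ennreal (exp (- (s * (norm (x - (c + y)))\<^sup>2)) * exp (- (t * (norm (c + y))\<^sup>2)))
        = ennreal (exp (- (s * t / (s + t) * (norm x)\<^sup>2))) * ennreal (exp (- ((s + t) * (norm y)\<^sup>2)))"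
      by (simp add: ennreal_mult'[symmetric])
  qed
  also have "\<dots> = ennreal (exp (- (s * t / (s + t) * (norm x)\<^sup>2))) * ennreal ((pi / (s + t)) powr (real DIM('a) / 2))"
    using assms by (subst nn_integral_cmult, measurable) (subst nn_integral_gaussian, auto)
  finally show ?thesis
    by (simp add: ennreal_mult' mult.commute)
qed

section \<open>The Riesz composition integral\<close>

text \<open>
  This replaces a power of the norm, singular at the origin, by Gaussians, which multiply well. At
  \<open>z = 0\<close> it fails: the right side is infinite, while \<open>0 powr _\<close> is 0.
\<close>
lemma norm_powr_eq_gaussian_superposition:
  fixes z :: "'a::real_normed_vector"
  assumes "z \<noteq> 0" "0 < a"
  shows "ennreal (Gamma a * norm z powr (- (2 * a)))
    = (\<integral>\<^sup>+t\<in>{0<..}. ennreal (t powr (a - 1) * exp (- (t * (norm z)\<^sup>2))) \<partial>lborel)"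
proof -
  have "((norm z)\<^sup>2) powr (- a) = norm z powr (- (2 * a))"
    using assms powr_powr[of "norm z" 2 "- a"] by simp
  then show ?thesis
    using nn_integral_Gamma_scaled[of a "(norm z)\<^sup>2"] assms by (simp add: mult.commute)
qed

text \<open>
  After \<open>s = t v\<close> the integrand is \<open>v^(A - 1) (1 + v)^(- N) t^(c - 1) exp(- r t v / (1 + v))\<close> with
  \<open>c = A + B - N\<close>, which is the function \<open>F v t\<close> of the proof. Integrating over \<open>t\<close> contributes
  \<open>\<Gamma>(c) (r v / (1 + v))^(- c)\<close> and leaves the Beta integral with parameters \<open>N - B\<close> and \<open>N - A\<close>. The
  three hypotheses on \<open>A\<close>, \<open>B\<close>, \<open>N\<close> say that \<open>c\<close> and both Beta parameters are positive.
\<close>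
lemma nn_integral_two_scales:
  fixes A B N r :: real
  assumes "A < N" "B < N" "N < A + B" "0 < r"
  shows "(\<integral>\<^sup>+t\<in>{0<..}. (\<integral>\<^sup>+s\<in>{0<..}.
            ennreal (s powr (A - 1) * t powr (B - 1) * (s + t) powr (- N) * exp (- (s * t / (s + t) * r)))
          \<partial>lborel) \<partial>lborel)
    = ennreal (Gamma (A + B - N) * r powr (- (A + B - N)) * Beta (N - B) (N - A))"
proof -
  define c where "c = A + B - N"
  define F where "F v t = ennreal (v powr (A - 1) * (1 + v) powr (- N) * (t powr (c - 1) * exp (- ((v / (1 + v) * r) * t))))"
    for v t :: real
  have [measurable]: "case_prod F \<in> borel_measurable (borel \<Otimes>\<^sub>M borel)"
    unfolding F_def by measurable
  have Gc: "0 < c" "0 < Gamma c"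
    using assms by (auto simp: c_def intro: Gamma_real_pos)
  have scale: "(\<integral>\<^sup>+s\<in>{0<..}.
            ennreal (s powr (A - 1) * t powr (B - 1) * (s + t) powr (- N) * exp (- (s * t / (s + t) * r))) \<partial>lborel)
      = (\<integral>\<^sup>+v\<in>{0<..}. F v t \<partial>lborel)" if t: "0 < t" for t
  proof -
    have "ennreal t * ennreal ((t * v) powr (A - 1) * t powr (B - 1) * (t * v + t) powr (- N) * exp (- (t * v * t / (t * v + t) * r)))
        = F v t" if v: "0 < v" for v
    proof -
      have "t * v + t = t * (1 + v)"
        by (simp add: algebra_simps)
      then have 1: "t * v * t / (t * v + t) * r = (v / (1 + v) * r) * t" "(t * v + t) powr (- N) = t powr (- N) * (1 + v) powr (- N)"
        using t v by (simp_all add: powr_mult)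
      have "t powr (c - 1) = t powr (1 + (A - 1) + (B - 1) + - N)"
        by (simp add: c_def algebra_simps)
      also have "\<dots> = t * t powr (A - 1) * t powr (B - 1) * t powr (- N)"
        unfolding powr_add using t by simp
      finally show ?thesis
        unfolding F_def 1 using t v by (simp add: powr_mult ennreal_mult'[symmetric] mult_ac)
    qed
    then show ?thesis
      using t by (subst nn_integral_half_line_scale[OF _ t], measurable, subst nn_integral_cmult[symmetric])
         (auto intro!: nn_integral_cong simp: mult.assoc[symmetric] split: split_indicator)
  qed
  have inner: "(\<integral>\<^sup>+t\<in>{0<..}. F v t \<partial>lborel)
      = ennreal (Gamma c * r powr (- c)) * ennreal (v powr ((N - B) - 1) * (1 + v) powr (- ((N - B) + (N - A))))"
    if v: "0 < v" for v
  proof -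
    have "(\<integral>\<^sup>+t\<in>{0<..}. F v t \<partial>lborel)
        = (\<integral>\<^sup>+t. ennreal (v powr (A - 1) * (1 + v) powr (- N))
            * (ennreal (t powr (c - 1) * exp (- ((v / (1 + v) * r) * t))) * indicator {0<..} t) \<partial>lborel)"
      unfolding F_def by (intro nn_integral_cong) (simp add: ennreal_mult' mult_ac)
    also have "\<dots> = ennreal (v powr (A - 1) * (1 + v) powr (- N)) * ennreal (Gamma c * (v / (1 + v) * r) powr (- c))"
      using assms Gc v by (subst nn_integral_cmult, measurable) (subst nn_integral_Gamma_scaled, auto)
    also have "\<dots> = ennreal (v powr (A - 1) * (1 + v) powr (- N) * (Gamma c * (v / (1 + v) * r) powr (- c)))"
      by (simp add: ennreal_mult'[symmetric])
    also have "(v / (1 + v) * r) powr (- c) = v powr (- c) * (1 + v) powr c * r powr (- c)"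
      using v assms by (simp add: powr_mult powr_divide powr_minus field_simps)
    also have "v powr (A - 1) * (1 + v) powr (- N) * (Gamma c * (v powr (- c) * (1 + v) powr c * r powr (- c)))
        = (Gamma c * r powr (- c)) * ((v powr (A - 1) * v powr (- c)) * ((1 + v) powr (- N) * (1 + v) powr c))"
      by (simp only: mult_ac)
    also have "\<dots> = (Gamma c * r powr (- c)) * (v powr ((N - B) - 1) * (1 + v) powr (- ((N - B) + (N - A))))"
      unfolding powr_add[symmetric] by (simp add: c_def algebra_simps)
    finally show ?thesis
      using Gc by (simp add: ennreal_mult')
  qed
  have "(\<integral>\<^sup>+t\<in>{0<..}. (\<integral>\<^sup>+s\<in>{0<..}.
            ennreal (s powr (A - 1) * t powr (B - 1) * (s + t) powr (- N) * exp (- (s * t / (s + t) * r)))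
          \<partial>lborel) \<partial>lborel) = (\<integral>\<^sup>+t\<in>{0<..}. (\<integral>\<^sup>+v\<in>{0<..}. F v t \<partial>lborel) \<partial>lborel)"
  proof (rule nn_integral_cong, goal_cases)
    case (1 t)
    then show ?case
      by (cases "0 < t", simp only: scale, simp)
  qed
  also have "\<dots> = (\<integral>\<^sup>+v\<in>{0<..}. (\<integral>\<^sup>+t\<in>{0<..}. F v t \<partial>lborel) \<partial>lborel)"
    by (intro nn_integral_quadrant_swap) measurable
  also have "\<dots> = (\<integral>\<^sup>+v. ennreal (Gamma c * r powr (- c))
        * (ennreal (v powr ((N - B) - 1) * (1 + v) powr (- ((N - B) + (N - A)))) * indicator {0<..} v) \<partial>lborel)"
    by (intro nn_integral_cong) (simp add: inner split: split_indicator)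
  also have "\<dots> = ennreal (Gamma c * r powr (- c)) * ennreal (Beta (N - B) (N - A))"
    using assms by (subst nn_integral_cmult, measurable) (subst nn_integral_beta_second_kind, auto)
  finally show ?thesis
    using Gc by (simp add: ennreal_mult'[symmetric] c_def)
qed

text \<open>
  The bounds \<open>a < n\<close> and \<open>b < n\<close> make the singularities at \<open>y = x\<close> and \<open>y = 0\<close> integrable, and
  \<open>n < a + b\<close> makes the integrand integrable at infinity. Positivity of \<open>a\<close> and \<open>b\<close> is what the
  Gaussian superpositions of the two powers require. Halving all exponents, as \<open>A\<close>, \<open>B\<close> and \<open>N\<close> do in
  the proof, accounts for the square of the norm in the Gaussian.
\<close>
lemma nn_integral_riesz_composition:
  fixes x :: "'a::euclidean_space" and a b :: real
  assumes "0 < a" "0 < b" "a < DIM('a)" "b < DIM('a)" "DIM('a) < a + b" "x \<noteq> 0"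
  defines "n \<equiv> real DIM('a)"
  shows "(\<integral>\<^sup>+y. ennreal (norm (x - y) powr (- a) * norm y powr (- b)) \<partial>lborel)
    = ennreal (pi powr (n / 2) * Gamma ((a + b - n) / 2) * Beta ((n - b) / 2) ((n - a) / 2)
        / (Gamma (a / 2) * Gamma (b / 2)) * norm x powr (n - a - b))"
proof -
  define A B N where "A = a / 2" and "B = b / 2" and "N = n / 2"
  have AB: "0 < A" "0 < B" "A < N" "B < N" "N < A + B"
    using assms by (auto simp: A_def B_def N_def)
  have Gpos: "0 < Gamma A" "0 < Gamma B"
    using AB by (auto intro: Gamma_real_pos)
  define F where "F t s y = ennreal (s powr (A - 1) * t powr (B - 1))
      * ennreal (exp (- (s * (norm (x - y))\<^sup>2)) * exp (- (t * (norm y)\<^sup>2)))" for t s :: real and y :: 'a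
  have [measurable]: "(\<lambda>(t, y). \<integral>\<^sup>+s\<in>{0<..}. F t s y \<partial>lborel) \<in> borel_measurable (borel \<Otimes>\<^sub>M borel)"
    unfolding F_def by measurable
  have F_measurable: "(\<lambda>(s, y). F t s y) \<in> borel_measurable (borel \<Otimes>\<^sub>M borel)" for t
    unfolding F_def by measurable
  have superpose: "ennreal (Gamma A * Gamma B) * ennreal (norm (x - y) powr (- a) * norm y powr (- b))
      = (\<integral>\<^sup>+t\<in>{0<..}. (\<integral>\<^sup>+s\<in>{0<..}. F t s y \<partial>lborel) \<partial>lborel)" if "y \<noteq> 0" "y \<noteq> x" for y
  proof -
    have "ennreal (Gamma A * Gamma B) * ennreal (norm (x - y) powr (- a) * norm y powr (- b))
       = ennreal (Gamma A * norm (x - y) powr (- (2 * A))) * ennreal (Gamma B * norm y powr (- (2 * B)))"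
      using Gpos by (simp add: ennreal_mult'[symmetric] A_def B_def mult_ac)
    also have "\<dots> = (\<integral>\<^sup>+s\<in>{0<..}. ennreal (s powr (A - 1) * exp (- (s * (norm (x - y))\<^sup>2))) \<partial>lborel)
         * (\<integral>\<^sup>+t\<in>{0<..}. ennreal (t powr (B - 1) * exp (- (t * (norm y)\<^sup>2))) \<partial>lborel)"
      using that AB by (simp add: norm_powr_eq_gaussian_superposition)
    also have "\<dots> = (\<integral>\<^sup>+t. (\<integral>\<^sup>+s\<in>{0<..}. ennreal (s powr (A - 1) * exp (- (s * (norm (x - y))\<^sup>2))) \<partial>lborel)
         * (ennreal (t powr (B - 1) * exp (- (t * (norm y)\<^sup>2))) * indicator {0<..} t) \<partial>lborel)"
      by (intro nn_integral_cmult[symmetric]) measurable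
    also have "\<dots> = (\<integral>\<^sup>+t\<in>{0<..}. (\<integral>\<^sup>+s\<in>{0<..}. F t s y \<partial>lborel) \<partial>lborel)"
    proof (intro nn_integral_cong)
      fix t :: real
      have "(\<integral>\<^sup>+s\<in>{0<..}. ennreal (s powr (A - 1) * exp (- (s * (norm (x - y))\<^sup>2))) \<partial>lborel)
           * ennreal (t powr (B - 1) * exp (- (t * (norm y)\<^sup>2))) = (\<integral>\<^sup>+s\<in>{0<..}. F t s y \<partial>lborel)"
        unfolding F_def
        by (subst nn_integral_multc[symmetric]) (auto intro!: nn_integral_cong simp: ennreal_mult' mult_ac)
      then show "(\<integral>\<^sup>+s\<in>{0<..}. ennreal (s powr (A - 1) * exp (- (s * (norm (x - y))\<^sup>2))) \<partial>lborel)
         * (ennreal (t powr (B - 1) * exp (- (t * (norm y)\<^sup>2))) * indicator {0<..} t)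
         = (\<integral>\<^sup>+s\<in>{0<..}. F t s y \<partial>lborel) * indicator {0<..} t"
        by (simp add: mult.assoc[symmetric])
    qed
    finally show ?thesis .
  qed
  have gauss: "(\<integral>\<^sup>+y. F t s y \<partial>lborel) = ennreal (pi powr N)
      * ennreal (s powr (A - 1) * t powr (B - 1) * (s + t) powr (- N) * exp (- (s * t / (s + t) * (norm x)\<^sup>2)))"
    if "0 < s" "0 < t" for s t
  proof -
    have "(pi / (s + t)) powr N = pi powr N * (s + t) powr (- N)"
      using that by (simp add: powr_divide powr_minus field_simps)
    then show ?thesis
      unfolding F_def using that
      by (subst nn_integral_cmult, measurable)
         (subst nn_integral_gaussian_product[OF that],
          simp add: ennreal_mult'[symmetric] N_def n_def mult_ac)
  qed
  have "ennreal (Gamma A * Gamma B) * (\<integral>\<^sup>+y. ennreal (norm (x - y) powr (- a) * norm y powr (- b)) \<partial>lborel)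
      = (\<integral>\<^sup>+y. ennreal (Gamma A * Gamma B) * ennreal (norm (x - y) powr (- a) * norm y powr (- b)) \<partial>lborel)"
    by (intro nn_integral_cmult[symmetric]) measurable
  also have "\<dots> = (\<integral>\<^sup>+y. (\<integral>\<^sup>+t\<in>{0<..}. (\<integral>\<^sup>+s\<in>{0<..}. F t s y \<partial>lborel) \<partial>lborel) \<partial>lborel)"
  proof (rule nn_integral_cong_AE)
    \<comment> \<open>Only almost everywhere: the superposition is infinite at the singular points \<open>x\<close> and \<open>0\<close>.\<close>
    show "AE y in lborel. ennreal (Gamma A * Gamma B) * ennreal (norm (x - y) powr (- a) * norm y powr (- b))
        = (\<integral>\<^sup>+t\<in>{0<..}. (\<integral>\<^sup>+s\<in>{0<..}. F t s y \<partial>lborel) \<partial>lborel)"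
      using AE_lborel_singleton[of x] AE_lborel_singleton[of "0::'a"]
      by eventually_elim (rule superpose)
  qed
  also have "\<dots> = (\<integral>\<^sup>+t\<in>{0<..}. (\<integral>\<^sup>+y. (\<integral>\<^sup>+s\<in>{0<..}. F t s y \<partial>lborel) \<partial>lborel) \<partial>lborel)"
    by (intro nn_integral_half_line_swap) measurable
  also have "\<dots> = (\<integral>\<^sup>+t\<in>{0<..}. (\<integral>\<^sup>+s\<in>{0<..}. (\<integral>\<^sup>+y. F t s y \<partial>lborel) \<partial>lborel) \<partial>lborel)"
    by (simp only: nn_integral_half_line_swap[OF F_measurable])
  also have "\<dots> = (\<integral>\<^sup>+t\<in>{0<..}. (\<integral>\<^sup>+s. ennreal (pi powr N)
      * (ennreal (s powr (A - 1) * t powr (B - 1) * (s + t) powr (- N) * exp (- (s * t / (s + t) * (norm x)\<^sup>2)))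
         * indicator {0<..} s) \<partial>lborel) \<partial>lborel)"
    by (intro nn_integral_cong) (auto intro!: nn_integral_cong simp: gauss mult.assoc split: split_indicator)
  also have "\<dots> = (\<integral>\<^sup>+t. ennreal (pi powr N) * ((\<integral>\<^sup>+s\<in>{0<..}.
      ennreal (s powr (A - 1) * t powr (B - 1) * (s + t) powr (- N) * exp (- (s * t / (s + t) * (norm x)\<^sup>2)))
         \<partial>lborel) * indicator {0<..} t) \<partial>lborel)"
    by (intro nn_integral_cong, subst nn_integral_cmult) (measurable, simp add: mult.assoc)
  also have "\<dots> = ennreal (pi powr N) * (\<integral>\<^sup>+t\<in>{0<..}. (\<integral>\<^sup>+s\<in>{0<..}.
      ennreal (s powr (A - 1) * t powr (B - 1) * (s + t) powr (- N) * exp (- (s * t / (s + t) * (norm x)\<^sup>2)))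
         \<partial>lborel) \<partial>lborel)"
    by (intro nn_integral_cmult) measurable
  also have "\<dots> = ennreal (pi powr N) * ennreal (Gamma (A + B - N) * ((norm x)\<^sup>2) powr (- (A + B - N)) * Beta (N - B) (N - A))"
    using AB assms by (subst nn_integral_two_scales) auto
  also have "\<dots> = ennreal (pi powr N * Gamma (A + B - N) * Beta (N - B) (N - A) * norm x powr (n - a - b))"
  proof -
    have "((norm x)\<^sup>2) powr (- (A + B - N)) = norm x powr (n - a - b)"
      using \<open>x \<noteq> 0\<close> powr_powr[of "norm x" 2 "- (A + B - N)"] by (simp add: A_def B_def N_def algebra_simps)
    then show ?thesis
      by (simp add: ennreal_mult'[symmetric] mult_ac)
  qed
  finally have "ennreal (inverse (Gamma A * Gamma B)) * (ennreal (Gamma A * Gamma B)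
      * (\<integral>\<^sup>+y. ennreal (norm (x - y) powr (- a) * norm y powr (- b)) \<partial>lborel))
    = ennreal (inverse (Gamma A * Gamma B)) * ennreal (pi powr N * Gamma (A + B - N) * Beta (N - B) (N - A) * norm x powr (n - a - b))"
    by simp
  moreover have "ennreal (inverse (Gamma A * Gamma B)) * ennreal (Gamma A * Gamma B) = 1"
    using Gpos by (simp add: ennreal_mult'[symmetric] field_simps)
  moreover have "A + B - N = (a + b - n) / 2" "N - B = (n - b) / 2" "N - A = (n - a) / 2"
    by (simp_all add: A_def B_def N_def field_simps)
  ultimately show ?thesis
    using Gpos unfolding mult.assoc[symmetric]
    by (simp add: ennreal_mult'[symmetric] A_def[symmetric] B_def[symmetric] N_def[symmetric] field_simps)
qed

section \<open>The power solution\<close>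

theorem theorem1p1:
  fixes f :: "real ^ 'n \<Rightarrow> real" and n :: nat and lam p :: real
  assumes "n = CARD('n)"
    and "0 < lam" and "lam < real n"
    and "p = 2 * real n / (2 * real n - lam)"
    and "\<And>x. x \<noteq> 0 \<Longrightarrow> f x = riesz_C n lam * norm x powr (- (real n - lam / 2))"
  shows "solves_riesz_equation lam p f"
  unfolding solves_riesz_equation_def
proof (intro allI impI)
  fix x :: "real ^ 'n"
  assume x: "x \<noteq> 0"
  define K where "K = pi powr (real n / 2) * Gamma (real n / 2 - lam / 2) * (Gamma (lam / 4))\<^sup>2 /
       (Gamma (lam / 2) * (Gamma (real n / 2 - lam / 4))\<^sup>2)"
  define C where "C = riesz_C n lam"
  define b where "b = real n - lam / 2"
  have "0 < Gamma (real n / 2 - lam / 2)" "0 < Gamma (lam / 4)" "0 < Gamma (lam / 2)" "0 < Gamma (real n / 2 - lam / 4)"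
    using assms(2,3) by (auto intro!: Gamma_real_pos)
  then have K: "0 < K"
    by (simp add: K_def)
  have C_eq: "C = K powr (- ((2 * real n - lam) / (2 * (real n - lam))))"
    by (simp add: C_def riesz_C_def K_def)
  then have C: "0 < C"
    using K by simp
  \<comment> \<open>The equation that determines the constant: \<open>C\<close> is \<open>K\<close> to the power \<open>1 / (p - 2)\<close>.\<close>
  have CK: "C * K = C powr (p - 1)"
  proof -
    define D M where "D = 2 * real n - lam" and "M = real n - lam"
    have DM: "0 < D" "0 < M"
      using assms(2,3) by (auto simp: D_def M_def)
    have p1: "p - 1 = 1 - 2 * M / D"
      unfolding assms(4) using DM by (simp add: D_def M_def field_simps)
    have "- (D / (2 * M)) * (p - 1) = - (D / (2 * M)) + 1"
      unfolding p1 using DM by (simp add: field_simps)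
    then have "- ((2 * real n - lam) / (2 * (real n - lam))) * (p - 1)
        = - ((2 * real n - lam) / (2 * (real n - lam))) + 1"
      by (simp only: D_def M_def)
    then show ?thesis
      unfolding C_eq powr_powr using K by (simp only: powr_add) simp
  qed
  have b_p: "b * (p - 1) = lam / 2"
    unfolding b_def assms(4) using assms(2,3) by (simp add: field_simps)
  let ?h = "\<lambda>y. norm (x - y) powr (- lam) * f y"
  \<comment> \<open>The unspecified value \<open>f 0\<close> has to be carried along for measurability.\<close>
  have f_eq: "f = (\<lambda>y. if y = 0 then f 0 else C * norm y powr (- b))"
    using assms(5) by (auto simp: C_def b_def)
  have h_borel: "?h \<in> borel_measurable borel"
    by (subst f_eq) measurable
  then have h_meas: "?h \<in> borel_measurable lebesgue"
    by (intro measurable_completion) simp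
  have h_eq: "AE y in lborel. ?h y = C * (norm (x - y) powr (- lam) * norm y powr (- b))"
    using AE_lborel_singleton[of "0 :: real ^ 'n"] by eventually_elim (simp add: assms(5) C_def b_def)
  have h_nonneg: "AE y in lebesgue. 0 \<le> ?h y"
  proof (rule AE_completion)
    show "AE y in lborel. 0 \<le> ?h y"
      using h_eq by eventually_elim (use C in auto)
  qed
  have riesz: "(\<integral>\<^sup>+y. ennreal (norm (x - y) powr (- lam) * norm y powr (- b)) \<partial>lborel)
      = ennreal (K * norm x powr (- (lam / 2)))"
  proof -
    have exps: "(lam + b - real n) / 2 = lam / 4" "(real n - b) / 2 = lam / 4" "b / 2 = real n / 2 - lam / 4"
      "(real n - lam) / 2 = real n / 2 - lam / 2" "real n - lam - b = - (lam / 2)"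
      "lam / 4 + (real n / 2 - lam / 2) = real n / 2 - lam / 4"
      by (simp_all add: b_def field_simps)
    have dim: "real DIM(real ^ 'n) = real n"
      using assms(1) by simp
    have "lam < real n" "b < real n" "real n < lam + b" "0 < b"
      using assms(2,3) by (auto simp: b_def)
    then have "(\<integral>\<^sup>+y. ennreal (norm (x - y) powr (- lam) * norm y powr (- b)) \<partial>lborel)
      = ennreal (pi powr (real n / 2) * Gamma ((lam + b - real n) / 2) * Beta ((real n - b) / 2) ((real n - lam) / 2)
        / (Gamma (lam / 2) * Gamma (b / 2)) * norm x powr (real n - lam - b))"
      using nn_integral_riesz_composition[of lam b x] assms(2) x unfolding dim by blast
    also have "\<dots> = ennreal (K * norm x powr (- (lam / 2)))"
      unfolding exps Beta_def K_def power2_eq_square by (simp add: field_simps)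
    finally show ?thesis .
  qed
  have "(\<integral>\<^sup>+y. ennreal (?h y) \<partial>lborel)
      = (\<integral>\<^sup>+y. ennreal C * ennreal (norm (x - y) powr (- lam) * norm y powr (- b)) \<partial>lborel)"
  proof (rule nn_integral_cong_AE)
    show "AE y in lborel. ennreal (?h y) = ennreal C * ennreal (norm (x - y) powr (- lam) * norm y powr (- b))"
      using h_eq by eventually_elim (use C in \<open>simp only: ennreal_mult'[symmetric] less_imp_le\<close>)
  qed
  also have "\<dots> = ennreal C * ennreal (K * norm x powr (- (lam / 2)))"
    by (subst nn_integral_cmult) (measurable, simp only: riesz)
  also have "\<dots> = ennreal (f x powr (p - 1))"
  proof -
    have "f x powr (p - 1) = C powr (p - 1) * norm x powr (- (b * (p - 1)))"
      using C x by (simp add: assms(5) C_def[symmetric] b_def[symmetric] powr_mult powr_powr)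
    then show ?thesis
      unfolding b_p using C CK by (simp add: ennreal_mult'[symmetric] mult.assoc[symmetric])
  qed
  finally have "(\<integral>\<^sup>+y. ennreal (?h y) \<partial>lebesgue) = ennreal (f x powr (p - 1))"
    by (simp add: nn_integral_completion)
  then show "integrable lebesgue ?h \<and> (LINT y|lebesgue. ?h y) = f x powr (p - 1)"
    using integrableI_nn_integral_finite[OF h_meas h_nonneg] integral_eq_nn_integral[OF h_meas h_nonneg]
    by simp
qed
end
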